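(* Let $G$ be a group with identity $1_G$ and let $A\subseteq G$ be a finite subset. Put $A_{>2}=\{a\in A: a^{-1}\ne a\}$, $A_2=\{a\in A: a^{-1}=a\ne 1_G\}$ and $A_{>1}=\{a\in A: a\ne 1_G\}$. Then $$\Delta[A]\ge \frac{1+\sqrt{4|A_{>2}|+8|A_2|+1}}{2}\ge \frac{1+\sqrt{4|A_{>1}|+1}}{2}.$$
   Context: For a subset $A$ of a group $G$, a subset $B\subseteq G$ is a difference basis for $A$ if every $a\in A$ can be written as $a=xy^{-1}$ with $x,y\in B$. The difference size $\Delta[A]$ is the smallest cardinality of a difference basis for $A$.
   Formalization: The finite subset A is assumed nonempty: for A empty the empty set is a difference basis, so Δ[A] = 0, while the claimed lower bound equals 1, and the first inequality fails. *)

theory Defs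
  imports Complex_Main "HOL-Algebra.Group"
begin

definition difference_basis :: "('a, 'b) monoid_scheme \<Rightarrow> 'a set \<Rightarrow> 'a set \<Rightarrow> bool" where
  "difference_basis G A B \<longleftrightarrow>
     B \<subseteq> carrier G \<and> (\<forall>a\<in>A. \<exists>x\<in>B. \<exists>y\<in>B. a = x \<otimes>\<^bsub>G\<^esub> inv\<^bsub>G\<^esub> y)"

(* Only meaningful when A has a finite difference basis, which is the case for every finite
   subset A of a group (take A together with the identity). The explicit finiteness of B
   is needed because card is 0 on infinite sets. *)
definition difference_size :: "('a, 'b) monoid_scheme \<Rightarrow> 'a set \<Rightarrow> nat" where
  "difference_size G A = (LEAST n. \<exists>B. difference_basis G A B \<and> finite B \<and> card B = n)"

end

(* If B is a difference basis of A with n elements, then the quotient map (x, y) \<mapsto> x y\<inverse> on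
   the n(n - 1) pairs of distinct elements of B covers A - {1}. A non-identity involution is hit by
   both (x, y) and (y, x), so that |A\<^sub>>\<^sub>2| + 2|A\<^sub>2| \<le> n(n - 1); solving for n gives the bound. *)
theory Submission imports Defs begin

lemma (in group) difference_basis_exists:
  assumes "A \<subseteq> carrier G" "finite A"
  shows "\<exists>B. difference_basis G A B \<and> finite B"
proof (intro exI conjI)
  show "difference_basis G A (insert \<one> A)"
    unfolding difference_basis_def
  proof (intro conjI ballI)
    fix a assume "a \<in> A"
    with assms(1) have "a = a \<otimes> inv \<one>" by auto
    with \<open>a \<in> A\<close> show "\<exists>x\<in>insert \<one> A. \<exists>y\<in>insert \<one> A. a = x \<otimes> inv y" by blast
  qed (use assms(1) in auto)
qed (use assms(2) in auto)

text \<open>Since some finite difference basis exists, the \<open>LEAST\<close> ranges over a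
  nonempty set of cardinalities and is attained; later arguments can work with an actual minimal
  basis.\<close>

lemma (in group) difference_size_attained:
  assumes "A \<subseteq> carrier G" "finite A"
  obtains B where "difference_basis G A B" "finite B" "card B = difference_size G A"
proof -
  have "\<exists>n B. difference_basis G A B \<and> finite B \<and> card B = n"
    using difference_basis_exists[OF assms] by blast
  from LeastI_ex[OF this] show thesis
    unfolding difference_size_def[symmetric] using that by blast
qed

text \<open>The count works for every finite difference basis, minimal or not. The natural-number
  subtraction loses nothing, because n \<le> n * n.\<close>

lemma (in group) difference_basis_card_bound:
  assumes "difference_basis G A B" "finite B" "finite A"
  shows "card {a \<in> A. inv a \<noteq> a} + 2 * card {a \<in> A. inv a = a \<and> a \<noteq> \<one>}
           \<le> card B * card B - card B"
proof -
  define P where "P = {a \<in> A. inv a \<noteq> a}"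
  define Q where "Q = {a \<in> A. inv a = a \<and> a \<noteq> \<one>}"
  define q where "q = (\<lambda>(x, y). x \<otimes> inv y)"
  have B: "B \<subseteq> carrier G" using assms(1) by (simp add: difference_basis_def)
  have "\<forall>a\<in>A. \<exists>z. z \<in> B \<times> B \<and> q z = a"
    using assms(1) by (fastforce simp: difference_basis_def q_def)
  \<comment> \<open>\<open>h\<close> chooses one representing pair for each element of
    \<open>A\<close>. The quotient map \<open>q\<close> is a left inverse of \<open>h\<close>, which
    makes \<open>h\<close> injective.\<close>
  then obtain h where h: "\<And>a. a \<in> A \<Longrightarrow> h a \<in> B \<times> B" and qh: "\<And>a. a \<in> A \<Longrightarrow> q (h a) = a"
    by metis
  have fst_neq_snd: "fst (h a) \<noteq> snd (h a)" if "a \<in> A" "a \<noteq> \<one>" for a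
  proof
    assume eq: "fst (h a) = snd (h a)"
    have "fst (h a) \<in> carrier G" using h[OF that(1)] B by auto
    then have "q (h a) = \<one>" using eq by (simp add: q_def case_prod_beta)
    with qh[OF that(1)] that(2) show False by simp
  qed
  \<comment> \<open>Swapping a pair inverts its quotient, so the swapped pair of an involution
    represents the same involution.\<close>
  have q_swap: "q (prod.swap (h a)) = inv a" if "a \<in> A" for a
  proof -
    have "fst (h a) \<in> carrier G" "snd (h a) \<in> carrier G" using h[OF that] B by auto
    then have "q (prod.swap (h a)) = inv (q (h a))"
      by (simp add: q_def case_prod_beta inv_mult_group)
    with qh[OF that] show ?thesis by simp
  qed
  have sub: "P \<subseteq> A" "Q \<subseteq> A" and disj: "P \<inter> Q = {}" and ne: "\<one> \<notin> P \<union> Q"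
    by (auto simp: P_def Q_def)
  have fin: "finite P" "finite Q" using sub assms(3) by (auto intro: finite_subset)
  have inj: "inj_on h (P \<union> Q)" by (rule inj_on_inverseI[where g = q]) (use sub qh in auto)
  have inj_swap: "inj_on (prod.swap \<circ> h) Q"
    by (rule comp_inj_on) (auto intro: inj_on_subset[OF inj])
  have disj_swap: "h ` (P \<union> Q) \<inter> (prod.swap \<circ> h) ` Q = {}"
  proof -
    \<comment> \<open>Applying \<open>q\<close> to both sides gives a = inv b = b. Then
      \<open>h b\<close> is fixed by the swap and so lies on the diagonal, which forces b to be the
      identity.\<close>
    have False if "a \<in> P \<union> Q" "b \<in> Q" "h a = prod.swap (h b)" for a b
    proof -
      have "a \<in> A" "b \<in> A" "b \<noteq> \<one>" "inv b = b" using that sub by (auto simp: Q_def)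
      then have "a = b" using qh q_swap that(3) by metis
      then show False using fst_neq_snd[of b] \<open>b \<in> A\<close> \<open>b \<noteq> \<one>\<close> that(3)
        by (metis fst_swap)
    qed
    then show ?thesis unfolding comp_def by blast
  qed
  have into: "h ` (P \<union> Q) \<union> (prod.swap \<circ> h) ` Q \<subseteq> B \<times> B - Id_on B"
  proof
    fix z assume "z \<in> h ` (P \<union> Q) \<union> (prod.swap \<circ> h) ` Q"
    then obtain a where a: "a \<in> P \<union> Q" and z: "z = h a \<or> z = prod.swap (h a)" by auto
    then have "a \<in> A" "a \<noteq> \<one>" using sub ne by auto
    with h fst_neq_snd z show "z \<in> B \<times> B - Id_on B"
      by (cases "h a") (fastforce simp: Id_on_iff)
  qed
  \<comment> \<open>\<open>P\<close> contributes one pair per element, \<open>Q\<close> two: the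
    chosen pair and its swap.\<close>
  have "card P + 2 * card Q = card (h ` (P \<union> Q)) + card ((prod.swap \<circ> h) ` Q)"
    by (simp only: card_image[OF inj] card_image[OF inj_swap] card_Un_disjoint[OF fin disj])
  also have "\<dots> = card (h ` (P \<union> Q) \<union> (prod.swap \<circ> h) ` Q)"
    using fin disj_swap by (intro card_Un_disjoint[symmetric]) auto
  also have "\<dots> \<le> card (B \<times> B - Id_on B)"
    using assms(2) into by (intro card_mono) auto
  also have "\<dots> = card B * card B - card B"
  proof -
    have "Id_on B = (\<lambda>x. (x, x)) ` B" by auto
    then have "card (Id_on B) = card B" by (simp add: card_image inj_on_def)
    moreover have "Id_on B \<subseteq> B \<times> B" by auto
    ultimately show ?thesis
      using assms(2) by (simp add: card_Diff_subset card_cartesian_product finite_subset)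
  qed
  finally show ?thesis by (simp add: P_def Q_def)
qed

theorem theorem3p1:
  fixes G :: "('a, 'b) monoid_scheme" (structure) and A :: "'a set"
  assumes "group G"
    and "A \<subseteq> carrier G"
    and "finite A"
    and "A \<noteq> {}"
  shows "real (difference_size G A) \<ge>
           (1 + sqrt (4 * real (card {a \<in> A. inv a \<noteq> a})
                      + 8 * real (card {a \<in> A. inv a = a \<and> a \<noteq> \<one>}) + 1)) / 2
       \<and> (1 + sqrt (4 * real (card {a \<in> A. inv a \<noteq> a})
                      + 8 * real (card {a \<in> A. inv a = a \<and> a \<noteq> \<one>}) + 1)) / 2
           \<ge> (1 + sqrt (4 * real (card {a \<in> A. a \<noteq> \<one>}) + 1)) / 2"
proof -
  interpret group G by fact
  let ?p = "card {a \<in> A. inv a \<noteq> a}" and ?q = "card {a \<in> A. inv a = a \<and> a \<noteq> \<one>}"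
  obtain B where B: "difference_basis G A B" "finite B" "card B = difference_size G A"
    using difference_size_attained[OF assms(2,3)] .
  define n where "n = card B"
  \<comment> \<open>For empty \<open>A\<close> the size would be 0 while the bound is 1.
    Nonemptiness gives n \<ge> 1, so that 2n - 1 is nonnegative when the root is taken.\<close>
  have "B \<noteq> {}" using B(1) assms(4) by (auto simp: difference_basis_def)
  then have n: "n \<ge> 1" using B(2) by (simp add: n_def Suc_le_eq card_gt_0_iff)
  have "?p + 2 * ?q \<le> n * n - n"
    unfolding n_def by (rule difference_basis_card_bound[OF B(1,2) assms(3)])
  then have "?p + 2 * ?q + n \<le> n * n" using le_square[of n] by linarith
  then have "real (?p + 2 * ?q + n) \<le> real (n * n)" by (rule of_nat_mono)
  \<comment> \<open>Multiply by 4 and complete the square: 4(n * n - n) + 1 is the square of 2n -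
    1.\<close>
  then have "4 * real ?p + 8 * real ?q + 1 \<le> (2 * real n - 1)\<^sup>2"
    by (simp add: power2_eq_square algebra_simps)
  then have "sqrt (4 * real ?p + 8 * real ?q + 1) \<le> 2 * real n - 1"
    using n by (intro real_le_lsqrt) auto
  \<comment> \<open>For the second inequality: the identity is its own inverse, so the two classes
    together make up the non-identity elements, and 4(p + q) \<le> 4p + 8q.\<close>
  moreover have "{a \<in> A. a \<noteq> \<one>} = {a \<in> A. inv a \<noteq> a} \<union> {a \<in> A. inv a = a \<and> a \<noteq> \<one>}"
    by auto
  then have "card {a \<in> A. a \<noteq> \<one>} \<le> ?p + ?q" by (simp only: card_Un_le)
  then have "sqrt (4 * real (card {a \<in> A. a \<noteq> \<one>}) + 1) \<le> sqrt (4 * real ?p + 8 * real ?q + 1)"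
    by (intro real_sqrt_le_mono) linarith
  ultimately show ?thesis using B(3) by (simp add: n_def field_simps)
qed

end
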